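(* Let $N>2$ and consider a CAV (vehicle $1$) followed by the HDVs $j\in\mathcal N_{\mathrm{HDV}}=\{2,\dots,N\}$, with $v_1(t^c)=v_j(t^c)=v_{\max}$ for all $j\in\mathcal N_{\mathrm{HDV}}$ and $\delta_N(t^c)>0$. Suppose the CAV is to complete the platoon transition step with its following HDVs using the control input $u_1(t)=u_p$, $t\in[t^c,t^s]$, within a control zone of length $L_c$. Then a platoon transition duration $\tau^t>0$ is feasible if $$\max\left\{C_1+\sqrt{C_1^2-\frac{2\Delta(t^c)}{u_{\min}}},\ \ 2C_1+\frac{2\Delta(t^c)}{v_1(t^c)-v_{\min}}\right\}\ \le\ \tau^t\ \le\ \frac{\phi_3+\sqrt{\phi_3^2+4\phi_4}}{2},$$ where $$C_1=\sum_{j=2}^{N-1}\rho_j,\quad C_2=L_c-v_1(t^c)\,\tau^s,\quad \phi_3=\frac{2C_1v_1(t^c)+\Delta(t^c)+C_2}{v_1(t^c)},\quad \phi_4=\frac{2\Delta(t^c)\,\tau^s-2C_1C_2}{v_1(t^c)} .$$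
   Context: Vehicles $\mathcal N=\{1,\dots,N\}$ travel on a single lane in this order, vehicle $1$ leading; vehicle $1$ is a connected and automated vehicle (CAV) and the others are human-driven vehicles (HDVs). The dynamics are $\dot p_i=v_i$, $\dot v_i=u_i$, where $p_i$ is the front-bumper position, $v_i$ the speed and $u_i$ the acceleration of vehicle $i$, subject to $0<v_{\min}\le v_i(t)\le v_{\max}$ and $u_{\min}\le u_i(t)\le u_{\max}$, where $v_{\min}<v_{\max}$ and $u_{\min}<0\le u_{\max}$. The CAV enters the control zone, of length $L_c>0$, at time $t^c$ and exits it at time $t^f$. All vehicles have length $l_c$. Dynamic following spacing: $s_i(t)=\rho_i v_i(t)+s_0$, with $\rho_i$ the desired time gap of HDV $i$ and $s_0$ the standstill distance. Platoon gap: $\delta_i(t)=p_{i-1}(t)-p_i(t)-s_i(t)-l_c$ for $i\ge2$. Cumulative platoon gap: $\Delta(t)=p_1(t)-p_N(t)-\sum_{j=2}^{N}(s_j(t)+l_c)$. CAV control: $u_1(t)=u_p$ for $t\in[t^c,t^s]$ and $u_1(t)=0$ for $t\in(t^s,t^f]$, with $u_p\in[u_{\min},0)$. The platoon transition step is completed at time $t^s=t^c+\tau^t$: at this time $\Delta(t^s)=0$, where the last HDV $N$ has travelled at speed $v_{\max}$ on $[t^c,t^s]$ (decoupled free-flow mode) and the intermediate HDVs $j=2,\dots,N-1$ are following the CAV with $v_j(t^s)=v_1(t^s)$. The platoon transition duration $\tau^t$ determines $u_p$ through $$2\Delta(t^c)+u_p(\tau^t)^2-2u_p\tau^t\sum_{j=2}^{N-1}\rho_j=0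 .$$ The subsequent platoon stabilization step has the given duration $\tau^s\ge0$; the platoon formation time is $t^p=t^c+\tau^t+\tau^s$. $\tau^t$ is called feasible if the corresponding $u_p$ satisfies $u_p\in[u_{\min},0)$, the resulting CAV trajectory satisfies the speed and acceleration bounds above, and platoon formation is completed within the control zone, i.e. $p_1(t^p)-p_1(t^c)\le L_c$.
   Formalization: The formal theorem additionally assumes Δ(t^c)>0, which δ_N(t^c)>0 alone does not give (for Δ(t^c)=0 one gets u_p=0, which is not feasible), and makes explicit that the desired time gaps ρ_j are nonnegative. *)

theory Defs
  imports "HOL-Analysis.Analysis"
begin

text \<open>
  Vehicles are indexed by \<open>1, \<dots>, N\<close>, vehicle \<open>1\<close> leading. The spacing and gap functions below are
  functions of the positions \<open>x\<close> and speeds \<open>w\<close> of the vehicles at one instant; their values at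
  time \<open>t\<close> along a motion are obtained with \<open>x = (\<lambda>i. p i t)\<close> and \<open>w = (\<lambda>i. v i t)\<close>.
\<close>

definition spacing :: "(nat \<Rightarrow> real) \<Rightarrow> real \<Rightarrow> (nat \<Rightarrow> real) \<Rightarrow> nat \<Rightarrow> real" where
  "spacing \<rho> s0 w i = \<rho> i * w i + s0"

definition platoon_gap ::
  "(nat \<Rightarrow> real) \<Rightarrow> real \<Rightarrow> real \<Rightarrow> (nat \<Rightarrow> real) \<Rightarrow> (nat \<Rightarrow> real) \<Rightarrow> nat \<Rightarrow> real" where
  "platoon_gap \<rho> s0 lc x w i = x (i - 1) - x i - spacing \<rho> s0 w i - lc"

definition cumulative_gap ::
  "nat \<Rightarrow> (nat \<Rightarrow> real) \<Rightarrow> real \<Rightarrow> real \<Rightarrow> (nat \<Rightarrow> real) \<Rightarrow> (nat \<Rightarrow> real) \<Rightarrow> real" where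
  "cumulative_gap N \<rho> s0 lc x w = x 1 - x N - (\<Sum>j = 2..N. spacing \<rho> s0 w j + lc)"

text \<open>
  Motion with position \<open>p\<close>, speed \<open>v\<close> and acceleration \<open>u\<close> on \<open>[a, b]\<close>. The finite exceptional set
  accommodates jumps of the control, where the speed has a kink.
\<close>

definition motion ::
  "real \<Rightarrow> real \<Rightarrow> (real \<Rightarrow> real) \<Rightarrow> (real \<Rightarrow> real) \<Rightarrow> (real \<Rightarrow> real) \<Rightarrow> bool" where
  "motion a b p v u \<longleftrightarrow>
     continuous_on {a..b} v \<and>
     (\<forall>t\<in>{a..b}. (p has_real_derivative v t) (at t within {a..b})) \<and>
     (\<exists>F. finite F \<and> (\<forall>t\<in>{a..b} - F. (v has_real_derivative u t) (at t within {a..b})))"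

definition cav_control :: "real \<Rightarrow> real \<Rightarrow> real \<Rightarrow> real" where
  "cav_control ts up t = (if t \<le> ts then up else 0)"

definition transition_equation :: "nat \<Rightarrow> (nat \<Rightarrow> real) \<Rightarrow> real \<Rightarrow> real \<Rightarrow> real \<Rightarrow> bool" where
  "transition_equation N \<rho> \<Delta> \<tau> up \<longleftrightarrow>
     2 * \<Delta> + up * \<tau>\<^sup>2 - 2 * up * \<tau> * (\<Sum>j = 2..N - 1. \<rho> j) = 0"

text \<open>
  The transition equation expresses that the cumulative gap vanishes at the end of the transition
  step, when HDV \<open>N\<close> travels at \<open>vmax\<close> and the HDVs in between have adapted to the speed of the CAV.
\<close>

lemma transition_equation_iff:
  fixes p v u :: "nat \<Rightarrow> real \<Rightarrow> real"
  assumes N: "N > 2" and \<tau>: "\<tau> \<ge> 0"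
    and mot: "\<And>i. i \<in> {1..N} \<Longrightarrow> motion tc (tc + \<tau>) (p i) (v i) (u i)"
    and init: "\<And>i. i \<in> {1..N} \<Longrightarrow> v i tc = vmax"
    and cav: "\<And>t. t \<in> {tc..tc + \<tau>} \<Longrightarrow> u 1 t = cav_control (tc + \<tau>) up t"
    and free: "\<And>t. t \<in> {tc..tc + \<tau>} \<Longrightarrow> v N t = vmax"
    and follow: "\<And>j. j \<in> {2..N - 1} \<Longrightarrow> v j (tc + \<tau>) = v 1 (tc + \<tau>)"
  shows "cumulative_gap N \<rho> s0 lc (\<lambda>i. p i (tc + \<tau>)) (\<lambda>i. v i (tc + \<tau>)) = 0 \<longleftrightarrow>
    transition_equation N \<rho> (cumulative_gap N \<rho> s0 lc (\<lambda>i. p i tc) (\<lambda>i. v i tc)) \<tau> up"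
proof -
  let ?I = "{tc..tc + \<tau>}"
  have m1: "motion tc (tc + \<tau>) (p 1) (v 1) (u 1)" and mN: "motion tc (tc + \<tau>) (p N) (v N) (u N)"
    using mot N by auto
  from m1 obtain F where F: "finite F"
    and dv: "\<And>t. t \<in> ?I - F \<Longrightarrow> (v 1 has_real_derivative u 1 t) (at t within ?I)"
    and cv: "continuous_on ?I (v 1)"
    and dp: "\<And>t. t \<in> ?I \<Longrightarrow> (p 1 has_real_derivative v 1 t) (at t within ?I)"
    unfolding motion_def by blast
  have v1: "v 1 t = vmax + up * (t - tc)" if t: "t \<in> ?I" for t
  proof -
    have sub: "{tc..t} \<subseteq> ?I" using t by auto
    have "((\<lambda>s. up) has_integral (v 1 t - v 1 tc)) {tc..t}"
    proof (rule fundamental_theorem_of_calculus_interior_strong[OF F])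
      show "tc \<le> t" using t by simp
      show "continuous_on {tc..t} (v 1)" using cv sub by (rule continuous_on_subset)
      fix s assume s: "s \<in> {tc<..<t} - F"
      then have sI: "s \<in> ?I - F" and int: "s \<in> interior ?I" using t by auto
      have "u 1 s = up" using cav[of s] sI by (auto simp: cav_control_def)
      then have "(v 1 has_real_derivative up) (at s)"
        using dv[OF sI] at_within_interior[OF int] by simp
      then show "(v 1 has_vector_derivative up) (at s)"
        by (simp add: has_real_derivative_iff_has_vector_derivative)
    qed
    moreover have "((\<lambda>s. up) has_integral (t - tc) * up) {tc..t}"
      using has_integral_const_real[of up tc t] t by simp
    ultimately have "v 1 t - v 1 tc = (t - tc) * up" by (rule has_integral_unique)
    then show ?thesis using init[of 1] N by (simp add: algebra_simps)
  qed
  have p1: "p 1 (tc + \<tau>) - p 1 tc = vmax * \<tau> + up * \<tau>\<^sup>2 / 2"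
  proof -
    have "(v 1 has_integral (p 1 (tc + \<tau>) - p 1 tc)) ?I"
      using fundamental_theorem_of_calculus[of tc "tc + \<tau>" "p 1" "v 1"] dp \<tau>
      by (simp add: has_real_derivative_iff_has_vector_derivative)
    moreover have "(v 1 has_integral
       ((vmax * (tc + \<tau>) + up * (tc + \<tau> - tc)\<^sup>2 / 2) - (vmax * tc + up * (tc - tc)\<^sup>2 / 2))) ?I"
    proof (rule fundamental_theorem_of_calculus)
      show "tc \<le> tc + \<tau>" using \<tau> by simp
      fix t assume t: "t \<in> ?I"
      show "((\<lambda>s. vmax * s + up * (s - tc)\<^sup>2 / 2) has_vector_derivative v 1 t) (at t within ?I)"
        unfolding has_real_derivative_iff_has_vector_derivative[symmetric] v1[OF t]
        by (auto intro!: derivative_eq_intros)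
    qed
    ultimately have "p 1 (tc + \<tau>) - p 1 tc =
       (vmax * (tc + \<tau>) + up * (tc + \<tau> - tc)\<^sup>2 / 2) - (vmax * tc + up * (tc - tc)\<^sup>2 / 2)"
      by (rule has_integral_unique)
    then show ?thesis by (simp add: algebra_simps)
  qed
  have pN: "p N (tc + \<tau>) - p N tc = vmax * \<tau>"
  proof -
    have "(v N has_integral (p N (tc + \<tau>) - p N tc)) ?I"
      using fundamental_theorem_of_calculus[of tc "tc + \<tau>" "p N" "v N"] mN \<tau>
      by (simp add: motion_def has_real_derivative_iff_has_vector_derivative)
    then have "((\<lambda>t. vmax) has_integral (p N (tc + \<tau>) - p N tc)) ?I"
      by (rule has_integral_eq[rotated]) (use free in auto)
    moreover have "((\<lambda>t. vmax) has_integral \<tau> * vmax) ?I"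
      using has_integral_const_real[of vmax tc "tc + \<tau>"] \<tau> by simp
    ultimately have "p N (tc + \<tau>) - p N tc = \<tau> * vmax" by (rule has_integral_unique)
    then show ?thesis by (simp add: mult.commute)
  qed
  have split: "{2..N} = insert N {2..N - 1}" "N \<notin> {2..N - 1}" using N by auto
  have S: "(\<Sum>j = 2..N. spacing \<rho> s0 (\<lambda>i. v i (tc + \<tau>)) j + lc) =
     (\<Sum>j = 2..N. spacing \<rho> s0 (\<lambda>i. v i tc) j + lc) + up * \<tau> * (\<Sum>j = 2..N - 1. \<rho> j)"
  proof -
    have "(\<Sum>j = 2..N - 1. spacing \<rho> s0 (\<lambda>i. v i (tc + \<tau>)) j + lc) =
       (\<Sum>j = 2..N - 1. (spacing \<rho> s0 (\<lambda>i. v i tc) j + lc) + up * \<tau> * \<rho> j)"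
    proof (rule sum.cong[OF refl])
      fix j assume j: "j \<in> {2..N - 1}"
      have "v j tc = vmax" using init[of j] j N by auto
      moreover have "v j (tc + \<tau>) = vmax + up * \<tau>" using follow[OF j] v1[of "tc + \<tau>"] \<tau> by simp
      ultimately show "spacing \<rho> s0 (\<lambda>i. v i (tc + \<tau>)) j + lc =
         (spacing \<rho> s0 (\<lambda>i. v i tc) j + lc) + up * \<tau> * \<rho> j"
        by (simp add: spacing_def algebra_simps)
    qed
    moreover have "v N (tc + \<tau>) = v N tc" using free[of tc] free[of "tc + \<tau>"] \<tau> by simp
    ultimately show ?thesis unfolding split(1)
      using split(2) by (simp add: sum.distrib sum_distrib_left spacing_def)
  qed
  have "2 * cumulative_gap N \<rho> s0 lc (\<lambda>i. p i (tc + \<tau>)) (\<lambda>i. v i (tc + \<tau>)) =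
     2 * cumulative_gap N \<rho> s0 lc (\<lambda>i. p i tc) (\<lambda>i. v i tc) + up * \<tau>\<^sup>2 -
       2 * up * \<tau> * (\<Sum>j = 2..N - 1. \<rho> j)"
    unfolding cumulative_gap_def S using p1 pN by (simp add: algebra_simps)
  then show ?thesis unfolding transition_equation_def by linarith
qed

text \<open>
  Feasibility of a transition duration \<open>\<tau>\<close> for the initial positions \<open>x\<close> and speeds \<open>w\<close> at time \<open>tc\<close>.
  The transition equation has to determine \<open>up\<close> uniquely. The motion of the CAV is unique on
  \<open>[tc, tf]\<close>, where \<open>tf\<close> is the time at which the CAV exits the control zone; the condition
  \<open>tc + \<tau> + \<tau>s \<le> tf\<close> says that the platoon formation time belongs to this interval.
\<close>

definition feasible_transition ::
  "nat \<Rightarrow> (nat \<Rightarrow> real) \<Rightarrow> real \<Rightarrow> real \<Rightarrow> real \<Rightarrow> real \<Rightarrow> real \<Rightarrow> real \<Rightarrow> real \<Rightarrow> real \<Rightarrow> real \<Rightarrow>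
   (nat \<Rightarrow> real) \<Rightarrow> (nat \<Rightarrow> real) \<Rightarrow> real \<Rightarrow> bool" where
  "feasible_transition N \<rho> s0 lc vmin vmax umin umax Lc tc \<tau>s x w \<tau> \<longleftrightarrow>
     (\<exists>up. (\<forall>a. transition_equation N \<rho> (cumulative_gap N \<rho> s0 lc x w) \<tau> a \<longleftrightarrow> a = up) \<and>
        umin \<le> up \<and> up < 0 \<and>
        (\<exists>tf p v u. tc + \<tau> + \<tau>s \<le> tf \<and>
           motion tc tf p v u \<and> p tc = x 1 \<and> v tc = w 1 \<and>
           (\<forall>t\<in>{tc..tf}. u t = cav_control (tc + \<tau>) up t) \<and>
           p tf - p tc = Lc \<and>
           (\<forall>t\<in>{tc..tf}. vmin \<le> v t \<and> v t \<le> vmax \<and> umin \<le> u t \<and> u t \<le> umax) \<and>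
           p (tc + \<tau> + \<tau>s) - p tc \<le> Lc))"

end

theory Submission
  imports Defs
begin

text \<open>
  Write \<open>V = vmax\<close>. Since \<open>\<tau> > 2 * C1\<close>, the transition equation is linear in the control with nonzero
  coefficient, and its solution is \<open>up = - 2 * \<Delta> / (\<tau> * (\<tau> - 2 * C1)) < 0\<close>. Under this control the
  CAV brakes from \<open>V\<close> to the final speed \<open>V + up * \<tau> = V - 2 * \<Delta> / (\<tau> - 2 * C1)\<close> and then keeps it.
  Each bound on \<open>\<tau>\<close> is one of the three remaining constraints solved for \<open>\<tau>\<close>: the first term of the
  maximum is \<open>umin \<le> up\<close>, which is quadratic in \<open>\<tau>\<close>; the second is \<open>vmin \<le> V + up * \<tau>\<close>; and the upper
  bound is the distance constraint at the formation time, which after multiplication by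
  \<open>(\<tau> - 2 * C1) / V > 0\<close> becomes \<open>\<tau>\<^sup>2 - \<phi>3 * \<tau> - \<phi>4 \<le> 0\<close>.

  The last inequality also bounds \<open>\<tau>\<close> from below by the smaller root of the quadratic. This costs
  nothing: at \<open>2 * C1\<close> only the terms that come from the braking survive, and the quadratic has the
  value \<open>- 2 * \<Delta> * (C1 + \<tau>s) / V \<le> 0\<close>. So its discriminant is nonnegative and
  \<open>2 * C1\<close>, hence also \<open>\<tau>\<close>, lies to the right of the smaller root
  (\<open>quadratic_nonpos_up_to_larger_root\<close>).

  The trajectory is given in closed form (\<open>motion_braking\<close>). As its final speed is positive, the CAV
  does reach the end of the control zone, and the distance constraint says precisely that this
  happens no earlier than the formation time (\<open>braking_exits_zone\<close>).
\<close>

section \<open>Quadratic inequalities\<close>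

text \<open>
  A point at which the quadratic is nonpositive lies between its roots, and so does everything from
  there to the larger root. The existence of such a point also makes the discriminant nonnegative, so
  that the square root has its usual meaning.
\<close>

lemma quadratic_nonpos_up_to_larger_root:
  fixes a b c t :: real
  assumes a: "a\<^sup>2 - b * a - c \<le> 0" and "a \<le> t" and t: "t \<le> (b + sqrt (b\<^sup>2 + 4 * c)) / 2"
  shows "t\<^sup>2 - b * t - c \<le> 0"
proof -
  have sq: "(2 * y - b)\<^sup>2 = 4 * (y\<^sup>2 - b * y - c) + (b\<^sup>2 + 4 * c)" for y
    by (simp add: power2_eq_square algebra_simps)
  have le: "(2 * a - b)\<^sup>2 \<le> b\<^sup>2 + 4 * c"
    unfolding sq using a by simp
  then have D: "0 \<le> b\<^sup>2 + 4 * c"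
    using zero_le_power2[of "2 * a - b"] by linarith
  have "\<bar>2 * a - b\<bar> \<le> sqrt (b\<^sup>2 + 4 * c)"
    using real_sqrt_le_mono[OF le] by simp
  then have "\<bar>2 * t - b\<bar> \<le> sqrt (b\<^sup>2 + 4 * c)"
    using \<open>a \<le> t\<close> t by (simp add: abs_le_iff)
  then have "(2 * t - b)\<^sup>2 \<le> b\<^sup>2 + 4 * c"
    using D sqrt_ge_absD by blast
  then show ?thesis
    unfolding sq by simp
qed

lemma quadratic_ge_beyond_larger_root:
  fixes c d t :: real
  assumes "c + sqrt (c\<^sup>2 + d) \<le> t" and "0 \<le> d"
  shows "d \<le> t * (t - 2 * c)"
proof -
  have "sqrt (c\<^sup>2 + d) \<le> t - c"
    using assms(1) by linarith
  then have "c\<^sup>2 + d \<le> (t - c)\<^sup>2"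
    by (rule sqrt_le_D)
  then show ?thesis
    by (simp add: power2_eq_square algebra_simps)
qed

section \<open>The control determined by the transition duration\<close>

lemma transition_equation_unique_solution:
  assumes "\<tau> \<noteq> 0" and "\<tau> \<noteq> 2 * (\<Sum>j = 2..N - 1. \<rho> j)"
  shows "transition_equation N \<rho> \<Delta> \<tau> a \<longleftrightarrow> a = - 2 * \<Delta> / (\<tau> * (\<tau> - 2 * (\<Sum>j = 2..N - 1. \<rho> j)))"
proof -
  let ?d = "\<tau> * (\<tau> - 2 * (\<Sum>j = 2..N - 1. \<rho> j))"
  have "transition_equation N \<rho> \<Delta> \<tau> a \<longleftrightarrow> a * ?d = - 2 * \<Delta>"
    unfolding transition_equation_def
    by (auto simp: power2_eq_square algebra_simps)
  also have "\<dots> \<longleftrightarrow> a = - 2 * \<Delta> / ?d"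
    using assms by (intro eq_divide_eq[THEN trans, symmetric]) auto
  finally show ?thesis .
qed

section \<open>Braking followed by constant speed\<close>

text \<open>
  The correction terms in \<open>max 0 (t - ts)\<close> cancel the braking after \<open>ts\<close>, which gives one formula for
  both phases.
\<close>

definition braking_speed :: "real \<Rightarrow> real \<Rightarrow> real \<Rightarrow> real \<Rightarrow> real \<Rightarrow> real" where
  "braking_speed tc ts V up t = V + up * (t - tc) - up * max 0 (t - ts)"

definition braking_position :: "real \<Rightarrow> real \<Rightarrow> real \<Rightarrow> real \<Rightarrow> real \<Rightarrow> real \<Rightarrow> real" where
  "braking_position tc ts x0 V up t =
     x0 + V * (t - tc) + up * (t - tc)\<^sup>2 / 2 - up * (max 0 (t - ts))\<^sup>2 / 2"

lemma has_real_derivative_max_0: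
  fixes b t :: real
  assumes "t \<noteq> b"
  shows "((\<lambda>t. max 0 (t - b)) has_real_derivative (if t \<le> b then 0 else 1)) (at t)"
proof (cases "t < b")
  case True
  have "((\<lambda>t. 0) has_real_derivative 0) (at t)" by simp
  then have "((\<lambda>t. max 0 (t - b)) has_real_derivative 0) (at t)"
    by (rule has_field_derivative_transform_within_open[of _ _ _ "{..<b}"]) (use True in auto)
  then show ?thesis using True by simp
next
  case False
  have "((\<lambda>t. t - b) has_real_derivative 1) (at t)"
    by (auto intro!: derivative_eq_intros)
  then have "((\<lambda>t. max 0 (t - b)) has_real_derivative 1) (at t)"
    by (rule has_field_derivative_transform_within_open[of _ _ _ "{b<..}"]) (use False assms in auto)
  then show ?thesis using False assms by simp
qed

text \<open>Squaring removes the kink: at \<open>b\<close> the difference quotient is \<open>max 0 (t - b)\<close>, which tends to 0.\<close>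

lemma has_real_derivative_max_0_squared:
  fixes b t :: real
  shows "((\<lambda>t. (max 0 (t - b))\<^sup>2) has_real_derivative 2 * max 0 (t - b)) (at t)"
proof (cases "t = b")
  case True
  have "((\<lambda>y. max 0 (y - b)) \<longlongrightarrow> max 0 (b - b)) (at b)"
    by (intro tendsto_intros)
  then have "((\<lambda>y. max 0 (y - b)) \<longlongrightarrow> 0) (at b)"
    by simp
  then have "((\<lambda>y. ((max 0 (y - b))\<^sup>2 - (max 0 (b - b))\<^sup>2) / (y - b)) \<longlongrightarrow> 0) (at b)"
    by (rule Lim_transform_eventually)
       (auto simp: eventually_at_filter max_def power2_eq_square)
  then show ?thesis
    using True by (simp add: has_field_derivative_iff)
next
  case False
  show ?thesis
    using DERIV_power[OF has_real_derivative_max_0[OF False], of 2] False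
    by (auto simp: max_def split: if_splits)
qed

lemma motion_braking:
  "motion tc tf (braking_position tc ts x0 V up) (braking_speed tc ts V up) (cav_control ts up)"
  unfolding motion_def
proof (intro conjI ballI exI[of _ "{ts}"])
  show "continuous_on {tc..tf} (braking_speed tc ts V up)"
    unfolding braking_speed_def by (intro continuous_intros)
next
  fix t
  have "((\<lambda>t. x0 + V * (t - tc) + up * (t - tc)\<^sup>2 / 2) has_real_derivative V + up * (t - tc)) (at t)"
    by (auto intro!: derivative_eq_intros)
  from DERIV_diff[OF this DERIV_cmult[OF has_real_derivative_max_0_squared, of "up / 2" ts t]]
  have "(braking_position tc ts x0 V up has_real_derivative braking_speed tc ts V up t) (at t)"
    by (simp add: braking_position_def[abs_def] braking_speed_def)
  then show "(braking_position tc ts x0 V up has_real_derivative braking_speed tc ts V up t)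
      (at t within {tc..tf})"
    by (rule has_field_derivative_at_within)
next
  show "finite {ts}" by simp
next
  fix t assume "t \<in> {tc..tf} - {ts}"
  then have t: "t \<noteq> ts" by simp
  have "((\<lambda>t. V + up * (t - tc)) has_real_derivative up) (at t)"
    by (auto intro!: derivative_eq_intros)
  from DERIV_diff[OF this DERIV_cmult[OF has_real_derivative_max_0[OF t], of up]]
  have "(braking_speed tc ts V up has_real_derivative cav_control ts up t) (at t)"
    by (simp add: braking_speed_def[abs_def] cav_control_def split: if_splits)
  then show "(braking_speed tc ts V up has_real_derivative cav_control ts up t)
      (at t within {tc..tf})"
    by (rule has_field_derivative_at_within)
qed

lemma braking_speed_bounds:
  assumes "up \<le> 0" and "tc \<le> ts" and "tc \<le> t"
  shows "V + up * (ts - tc) \<le> braking_speed tc ts V up t" and "braking_speed tc ts V up t \<le> V"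
proof -
  have eq: "braking_speed tc ts V up t = V + up * (min t ts - tc)"
    by (auto simp: braking_speed_def max_def min_def algebra_simps)
  show "V + up * (ts - tc) \<le> braking_speed tc ts V up t"
    unfolding eq using assms by (auto intro: mult_left_mono_neg)
  show "braking_speed tc ts V up t \<le> V"
    unfolding eq using assms by (auto intro: mult_nonpos_nonneg)
qed

lemma braking_position_initial:
  "tc \<le> ts \<Longrightarrow> braking_position tc ts x0 V up tc = x0"
  by (simp add: braking_position_def)

lemma braking_position_after:
  assumes "ts \<le> t"
  shows "braking_position tc ts x0 V up t =
    x0 + V * (ts - tc) + up * (ts - tc)\<^sup>2 / 2 + (V + up * (ts - tc)) * (t - ts)"
  using assms by (simp add: braking_position_def power2_eq_square field_simps)

lemma braking_exits_zone:
  assumes "0 < V + up * (ts - tc)" and "ts \<le> tp"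
    and "braking_position tc ts x0 V up tp - x0 \<le> L"
  obtains tf where "tp \<le> tf" and "braking_position tc ts x0 V up tf - x0 = L"
proof
  let ?p = "braking_position tc ts x0 V up" and ?v = "V + up * (ts - tc)"
  \<comment> \<open>The remaining distance at \<open>tp\<close>, covered at the final speed.\<close>
  let ?tf = "tp + (L - (?p tp - x0)) / ?v"
  show le: "tp \<le> ?tf"
    using assms by simp
  have "?p ?tf = ?p tp + ?v * (?tf - tp)"
    using assms(2) le by (simp add: braking_position_after algebra_simps)
  also have "?v * (?tf - tp) = L - (?p tp - x0)"
    using assms(1) by simp
  finally show "?p ?tf - x0 = L"
    by simp
qed

section \<open>Feasibility\<close>

text \<open>
  The infinitely many bounds along the trajectory reduce to single inequalities: bounding the speed at
  the end of the transition suffices because it is the lowest on the whole trajectory.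
\<close>

lemma feasible_transition_if_control:
  assumes unique: "\<And>a. transition_equation N \<rho> (cumulative_gap N \<rho> s0 lc x w) \<tau> a \<longleftrightarrow> a = up"
    and "umin \<le> up" and "up < 0" and "umin < 0" and "0 \<le> umax"
    and "0 < vmin" and "vmin \<le> vmax + up * \<tau>" and "w 1 = vmax" and "0 \<le> \<tau>" and "0 \<le> \<tau>s"
    and dist: "vmax * \<tau> + up * \<tau>\<^sup>2 / 2 + (vmax + up * \<tau>) * \<tau>s \<le> Lc"
  shows "feasible_transition N \<rho> s0 lc vmin vmax umin umax Lc tc \<tau>s x w \<tau>"
proof -
  let ?p = "braking_position tc (tc + \<tau>) (x 1) vmax up"
  let ?v = "braking_speed tc (tc + \<tau>) vmax up"
  let ?u = "cav_control (tc + \<tau>) up"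
  have p0: "?p tc = x 1"
    using \<open>0 \<le> \<tau>\<close> by (simp add: braking_position_initial)
  have ptp: "?p (tc + \<tau> + \<tau>s) - x 1 \<le> Lc"
    using dist \<open>0 \<le> \<tau>s\<close> by (simp add: braking_position_after)
  have "0 < vmax + up * (tc + \<tau> - tc)" and "tc + \<tau> \<le> tc + \<tau> + \<tau>s"
    using assms by auto
  then obtain tf where tf: "tc + \<tau> + \<tau>s \<le> tf" "?p tf - x 1 = Lc"
    using ptp by (rule braking_exits_zone)
  have bounds: "vmin \<le> ?v t \<and> ?v t \<le> vmax \<and> umin \<le> ?u t \<and> ?u t \<le> umax" if "t \<in> {tc..tf}" for t
    using braking_speed_bounds[of up tc "tc + \<tau>" t vmax] that assms by (auto simp: cav_control_def)
  have v0: "?v tc = w 1"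
    using \<open>0 \<le> \<tau>\<close> \<open>w 1 = vmax\<close> by (simp add: braking_speed_def)
  show ?thesis
    unfolding feasible_transition_def
  proof (rule exI[of _ up], intro conjI allI)
    show "\<exists>tf p v u. tc + \<tau> + \<tau>s \<le> tf \<and>
        motion tc tf p v u \<and> p tc = x 1 \<and> v tc = w 1 \<and>
        (\<forall>t\<in>{tc..tf}. u t = cav_control (tc + \<tau>) up t) \<and> p tf - p tc = Lc \<and>
        (\<forall>t\<in>{tc..tf}. vmin \<le> v t \<and> v t \<le> vmax \<and> umin \<le> u t \<and> u t \<le> umax) \<and>
        p (tc + \<tau> + \<tau>s) - p tc \<le> Lc"
      by (rule exI[of _ tf], rule exI[of _ ?p], rule exI[of _ ?v], rule exI[of _ ?u])
         (use tf p0 v0 ptp bounds motion_braking in auto)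
  qed (use assms in auto)
qed

theorem theorem4:
  fixes N :: nat
    and \<rho> x w :: "nat \<Rightarrow> real"
    and s0 lc vmin vmax umin umax Lc tc \<tau>s \<tau> \<Delta> C1 C2 \<phi>3 \<phi>4 :: real
  assumes "N > 2"
    and "0 < vmin" and "vmin < vmax"
    and "umin < 0" and "0 \<le> umax"
    and "Lc > 0" and "\<tau>s \<ge> 0"
    and "\<And>j. j \<in> {2..N} \<Longrightarrow> \<rho> j \<ge> 0"
    and "w 1 = vmax" and "\<And>j. j \<in> {2..N} \<Longrightarrow> w j = vmax"
    and "platoon_gap \<rho> s0 lc x w N > 0"
    and "\<Delta> = cumulative_gap N \<rho> s0 lc x w" and "\<Delta> > 0"
    and "C1 = (\<Sum>j = 2..N - 1. \<rho> j)"
    and "C2 = Lc - w 1 * \<tau>s"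
    and "\<phi>3 = (2 * C1 * w 1 + \<Delta> + C2) / w 1"
    and "\<phi>4 = (2 * \<Delta> * \<tau>s - 2 * C1 * C2) / w 1"
    and "\<tau> > 0"
    and "max (C1 + sqrt (C1\<^sup>2 - 2 * \<Delta> / umin)) (2 * C1 + 2 * \<Delta> / (w 1 - vmin)) \<le> \<tau>"
    and "\<tau> \<le> (\<phi>3 + sqrt (\<phi>3\<^sup>2 + 4 * \<phi>4)) / 2"
  shows "feasible_transition N \<rho> s0 lc vmin vmax umin umax Lc tc \<tau>s x w \<tau>"
proof -
  define d where "d = \<tau> - 2 * C1"
  define up where "up = - 2 * \<Delta> / (\<tau> * d)"
  have V: "0 < vmax" "0 < vmax - vmin"
    using assms(2,3) by auto
  have C1: "0 \<le> C1"
    unfolding assms(14) by (rule sum_nonneg) (use assms(8) in auto)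
  have lo: "C1 + sqrt (C1\<^sup>2 + - 2 * \<Delta> / umin) \<le> \<tau>" "2 * \<Delta> / (vmax - vmin) \<le> d"
    using assms(19) \<open>w 1 = vmax\<close> by (auto simp: d_def)
  have "0 < 2 * \<Delta> / (vmax - vmin)"
    using V \<open>\<Delta> > 0\<close> by simp
  then have d: "0 < d"
    using lo(2) by linarith
  have "- 2 * \<Delta> / umin \<le> \<tau> * d"
    unfolding d_def
    by (rule quadratic_ge_beyond_larger_root[OF lo(1)])
       (use assms(4,13) in \<open>simp add: divide_nonneg_neg\<close>)
  then have umin: "umin \<le> up"
    using \<open>umin < 0\<close> d \<open>\<tau> > 0\<close> by (simp add: up_def field_simps)
  have up\<tau>: "up * \<tau> = - 2 * \<Delta> / d"
    using \<open>\<tau> > 0\<close> by (simp add: up_def)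
  have vmin: "vmin \<le> vmax + up * \<tau>"
    unfolding up\<tau> using lo(2) d V by (simp add: field_simps)
  \<comment> \<open>At \<open>y = \<tau>\<close>, nonpositivity of this expression is the distance constraint multiplied by \<open>d\<close>.\<close>
  have q: "vmax * (y\<^sup>2 - \<phi>3 * y - \<phi>4) =
      vmax * y * (y - 2 * C1) - \<Delta> * y - 2 * \<Delta> * \<tau>s - C2 * (y - 2 * C1)" for y
    using V unfolding assms(16,17) \<open>w 1 = vmax\<close> by (simp add: field_simps power2_eq_square)
  have "vmax * ((2 * C1)\<^sup>2 - \<phi>3 * (2 * C1) - \<phi>4) = - 2 * (\<Delta> * (C1 + \<tau>s))"
    unfolding q by (simp add: algebra_simps)
  also have "\<dots> \<le> 0"
    using C1 \<open>\<Delta> > 0\<close> \<open>\<tau>s \<ge> 0\<close> by simp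
  finally have "vmax * ((2 * C1)\<^sup>2 - \<phi>3 * (2 * C1) - \<phi>4) \<le> 0" .
  then have "(2 * C1)\<^sup>2 - \<phi>3 * (2 * C1) - \<phi>4 \<le> 0"
    using V by (simp add: mult_le_0_iff)
  then have "\<tau>\<^sup>2 - \<phi>3 * \<tau> - \<phi>4 \<le> 0"
    by (rule quadratic_nonpos_up_to_larger_root) (use d assms(20) in \<open>auto simp: d_def\<close>)
  then have "vmax * (\<tau>\<^sup>2 - \<phi>3 * \<tau> - \<phi>4) \<le> 0"
    using V by (simp add: mult_le_0_iff)
  then have "vmax * \<tau> * d - \<Delta> * \<tau> - 2 * \<Delta> * \<tau>s \<le> C2 * d"
    unfolding q d_def by linarith
  then have "(vmax * \<tau> * d - \<Delta> * \<tau> - 2 * \<Delta> * \<tau>s) / d \<le> C2"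
    using d by (simp add: pos_divide_le_eq)
  also have "(vmax * \<tau> * d - \<Delta> * \<tau> - 2 * \<Delta> * \<tau>s) / d =
      vmax * \<tau> + (up * \<tau>) * \<tau> / 2 + (up * \<tau>) * \<tau>s"
    unfolding up\<tau> using d by (simp add: diff_divide_distrib)
  finally have "vmax * \<tau> + (up * \<tau>) * \<tau> / 2 + (up * \<tau>) * \<tau>s \<le> C2" .
  then have dist: "vmax * \<tau> + up * \<tau>\<^sup>2 / 2 + (vmax + up * \<tau>) * \<tau>s \<le> Lc"
    unfolding assms(15) \<open>w 1 = vmax\<close> by (simp add: power2_eq_square algebra_simps)
  have "up < 0"
    using \<open>\<tau> > 0\<close> \<open>\<Delta> > 0\<close> d by (simp add: up_def)
  have unique: "transition_equation N \<rho> (cumulative_gap N \<rho> s0 lc x w) \<tau> a \<longleftrightarrow> a = up" for a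
    unfolding up_def d_def assms(12,14)
    by (rule transition_equation_unique_solution) (use \<open>\<tau> > 0\<close> d in \<open>auto simp: d_def assms(14)\<close>)
  show ?thesis
    by (rule feasible_transition_if_control[OF unique umin \<open>up < 0\<close> assms(4,5,2) vmin assms(9) _
          \<open>\<tau>s \<ge> 0\<close> dist]) (use \<open>\<tau> > 0\<close> in simp)
qed

end
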